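(* Let $X$ be a nonempty set. Given $t\in \mathrm{T}(X)$, there are $t_1\in \mathrm{ST}(X)$, $t_2\in \mathrm{PT}(X)$, and $t_3\in \mathrm{PT}_{\mathrm{id}}(X)$ with $t=_E t_1$, $t=_{E_{\mathrm{rd}}}t_2$, and $t=_{E_{\mathrm{id,rd}}}t_3$.
   Context: $\mathrm{T}(X)$ is the set (and term algebra) of all terms built from elements of $X$, constants $\hat 0,\hat 1$, and binary symbols $\hat+,\hat\times$ (infix). $=_E$ is the smallest congruence on the term algebra $\mathrm{T}(X)$ containing, for all $a,b,c\in \mathrm{T}(X)$, the pairs $(a\hat+(b\hat+c),(a\hat+b)\hat+c)$, $(a\hat+b,b\hat+a)$, $(a\hat+\hat0,a)$, $(a\hat\times(b\hat\times c),(a\hat\times b)\hat\times c)$, $(\hat1\hat\times a,a)$, $(a\hat\times\hat1,a)$, $(a\hat\times\hat0,\hat0)$, $(\hat0\hat\times a,\hat0)$. $=_{E_{\mathrm{rd}}}$ is the smallest congruence containing these pairs and all $((a\hat+b)\hat\times c,(a\hat\times c)\hat+(b\hat\times c))$. $=_{E_{\mathrm{id,rd}}}$ is the smallest congruence containing all the previous pairs and all $(a\hat+a,a)$. A term $s$ is simple if $s=\hat 0$, or $s$ contains neither $\hat 0$ nor any subterm of the form $\hat 1\hat\times s'$ or $s'\hat\times\hat 1$. $\mathrm{ST}(X)$ is the set of simple terms. For $s,t\in \mathrm{ST}(X)$, $s=_{\mathrm{AC}}t$ means that $t$ is obtained from $s$ by finitely many steps, each replacing a subterm occurrence using, in either direction,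 one of: $a\hat+(b\hat+c)\leftrightarrow(a\hat+b)\hat+c$, $a\hat+b\leftrightarrow b\hat+a$, $a\hat\times(b\hat\times c)\leftrightarrow(a\hat\times b)\hat\times c$. A monomial term is a term built from elements of $X$ using only $\hat\times$. The set $\mathrm{PT}(X)$ of polynomial terms is the smallest $U\subseteq \mathrm{ST}(X)$ with: (a) $\hat 0,\hat 1$ and all monomial terms are in $U$; (b) if $s,t\in U\setminus\{\hat 0\}$ then $s\hat+t\in U$; (c) if $s$ is a monomial term and $t\in U\setminus\{\hat 0,\hat 1\}$ then $s\hat\times t\in U$. A sum term is a simple term $s_1\hat+s_2$ with $s_1,s_2\in \mathrm{ST}(X)\setminus\{\hat 0\}$; a product term is a simple term $s_1\hat\times s_2$ with $s_1,s_2\in \mathrm{ST}(X)\setminus\{\hat0,\hat1\}$. Each sum term is, up to omitted parentheses, uniquely $t_1\hat+\cdots\hat+t_n$ ($n\ge2$) with every $t_i$ a product term or in $X\cup\{\hat 1\}$ (its sum-product decomposition). $\mathrm{ST}_{\mathrm{id}}(X)$ is the smallest $U\subseteq \mathrm{ST}(X)$ with: (a) $\hat0,\hat1$ and all monomial terms are in $U$; (b) if $t$ is a sum term with sum-product decomposition $t_1\hat+\cdots\hat+t_n$, all $t_i\in U$, and $t_i\neq_{\mathrm{AC}}t_j$ for $i<j$, then $t\in U$; (c) if $s,t\in U\setminus\{\hat0,\hat1\}$ then $s\hat\times t\in U$. $\mathrm{PT}_{\mathrm{id}}(X)=\mathrm{PT}(X)\cap \mathrm{ST}_{\mathrm{id}}(X)$.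 *)

theory Defs
  imports Main
begin

datatype (vars: 'a) trm =
    Var 'a
  | Zero  ("\<^bold>0")
  | One  ("\<^bold>1")
  | Plus "'a trm" "'a trm"  (infixl "\<^bold>+" 65)
  | Times "'a trm" "'a trm"  (infixl "\<^bold>\<times>" 70)

definition T :: "'a set \<Rightarrow> 'a trm set" where
  "T X = {t. vars t \<subseteq> X}"

definition congruence :: "'a set \<Rightarrow> ('a trm \<times> 'a trm) set \<Rightarrow> bool" where
  "congruence X r \<longleftrightarrow> equiv (T X) r \<and>
     (\<forall>s s' t t'. (s, s') \<in> r \<longrightarrow> (t, t') \<in> r \<longrightarrow>
        (s \<^bold>+ t, s' \<^bold>+ t') \<in> r \<and> (s \<^bold>\<times> t, s' \<^bold>\<times> t') \<in> r)"

inductive_set gen_congruence :: "'a set \<Rightarrow> ('a trm \<times> 'a trm) set \<Rightarrow> ('a trm \<times> 'a trm) set"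
  for X :: "'a set" and R :: "('a trm \<times> 'a trm) set" where
  base: "(s, t) \<in> R \<Longrightarrow> (s, t) \<in> gen_congruence X R"
| refl: "t \<in> T X \<Longrightarrow> (t, t) \<in> gen_congruence X R"
| sym: "(s, t) \<in> gen_congruence X R \<Longrightarrow> (t, s) \<in> gen_congruence X R"
| trans: "\<lbrakk>(s, t) \<in> gen_congruence X R; (t, u) \<in> gen_congruence X R\<rbrakk>
    \<Longrightarrow> (s, u) \<in> gen_congruence X R"
| plus: "\<lbrakk>(s, s') \<in> gen_congruence X R; (t, t') \<in> gen_congruence X R\<rbrakk>
    \<Longrightarrow> (s \<^bold>+ t, s' \<^bold>+ t') \<in> gen_congruence X R"
| times: "\<lbrakk>(s, s') \<in> gen_congruence X R; (t, t') \<in> gen_congruence X R\<rbrakk>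
    \<Longrightarrow> (s \<^bold>\<times> t, s' \<^bold>\<times> t') \<in> gen_congruence X R"

lemma gen_congruence_subset:
  assumes "R \<subseteq> T X \<times> T X"
  shows "gen_congruence X R \<subseteq> T X \<times> T X"
proof -
  have "s \<in> T X \<and> t \<in> T X" if "(s, t) \<in> gen_congruence X R" for s t
    using that by induction (use assms in \<open>auto simp: T_def\<close>)
  then show ?thesis by auto
qed

lemma congruence_gen_congruence:
  assumes "R \<subseteq> T X \<times> T X"
  shows "congruence X (gen_congruence X R)"
  unfolding congruence_def equiv_def
  using gen_congruence_subset[OF assms]
  by (auto simp: refl_on_def intro!: symI transI intro: gen_congruence.intros)

lemma gen_congruence_least:
  assumes "congruence X r" "R \<subseteq> r"
  shows "gen_congruence X R \<subseteq> r"
proof -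
  have eq: "equiv (T X) r" using assms(1) by (simp add: congruence_def)
  have "(s, t) \<in> r" if "(s, t) \<in> gen_congruence X R" for s t
    using that
  proof induction
    case (refl t)
    then show ?case using eq by (meson equiv_def refl_onD)
  next
    case (sym s t)
    then show ?case using eq by (meson equiv_def symD)
  next
    case (trans s t u)
    then show ?case using eq by (meson equiv_def transD)
  qed (use assms in \<open>auto simp: congruence_def\<close>)
  then show ?thesis by auto
qed

inductive_set E_pairs :: "'a set \<Rightarrow> ('a trm \<times> 'a trm) set" for X :: "'a set" where
  "\<lbrakk>a \<in> T X; b \<in> T X; c \<in> T X\<rbrakk> \<Longrightarrow> (a \<^bold>+ (b \<^bold>+ c), (a \<^bold>+ b) \<^bold>+ c) \<in> E_pairs X"
| "\<lbrakk>a \<in> T X; b \<in> T X\<rbrakk> \<Longrightarrow> (a \<^bold>+ b, b \<^bold>+ a) \<in> E_pairs X"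
| "a \<in> T X \<Longrightarrow> (a \<^bold>+ \<^bold>0, a) \<in> E_pairs X"
| "\<lbrakk>a \<in> T X; b \<in> T X; c \<in> T X\<rbrakk> \<Longrightarrow> (a \<^bold>\<times> (b \<^bold>\<times> c), (a \<^bold>\<times> b) \<^bold>\<times> c) \<in> E_pairs X"
| "a \<in> T X \<Longrightarrow> (\<^bold>1 \<^bold>\<times> a, a) \<in> E_pairs X"
| "a \<in> T X \<Longrightarrow> (a \<^bold>\<times> \<^bold>1, a) \<in> E_pairs X"
| "a \<in> T X \<Longrightarrow> (a \<^bold>\<times> \<^bold>0, \<^bold>0) \<in> E_pairs X"
| "a \<in> T X \<Longrightarrow> (\<^bold>0 \<^bold>\<times> a, \<^bold>0) \<in> E_pairs X"

definition rd_pairs :: "'a set \<Rightarrow> ('a trm \<times> 'a trm) set" where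
  "rd_pairs X = {((a \<^bold>+ b) \<^bold>\<times> c, (a \<^bold>\<times> c) \<^bold>+ (b \<^bold>\<times> c)) | a b c. a \<in> T X \<and> b \<in> T X \<and> c \<in> T X}"

definition id_pairs :: "'a set \<Rightarrow> ('a trm \<times> 'a trm) set" where
  "id_pairs X = {(a \<^bold>+ a, a) | a. a \<in> T X}"

definition eq_E :: "'a set \<Rightarrow> ('a trm \<times> 'a trm) set" where
  "eq_E X = gen_congruence X (E_pairs X)"

definition eq_E_rd :: "'a set \<Rightarrow> ('a trm \<times> 'a trm) set" where
  "eq_E_rd X = gen_congruence X (E_pairs X \<union> rd_pairs X)"

definition eq_E_id_rd :: "'a set \<Rightarrow> ('a trm \<times> 'a trm) set" where
  "eq_E_id_rd X = gen_congruence X (E_pairs X \<union> rd_pairs X \<union> id_pairs X)"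

fun subterms :: "'a trm \<Rightarrow> 'a trm set" where
  "subterms (s \<^bold>+ t) = insert (s \<^bold>+ t) (subterms s \<union> subterms t)"
| "subterms (s \<^bold>\<times> t) = insert (s \<^bold>\<times> t) (subterms s \<union> subterms t)"
| "subterms t = {t}"

definition simple :: "'a trm \<Rightarrow> bool" where
  "simple s \<longleftrightarrow> s = \<^bold>0 \<or>
     (\<^bold>0 \<notin> subterms s \<and> (\<forall>s'. \<^bold>1 \<^bold>\<times> s' \<notin> subterms s \<and> s' \<^bold>\<times> \<^bold>1 \<notin> subterms s))"

definition ST :: "'a set \<Rightarrow> 'a trm set" where
  "ST X = {s \<in> T X. simple s}"

inductive AC_rule :: "'a trm \<Rightarrow> 'a trm \<Rightarrow> bool" where
  "AC_rule (a \<^bold>+ (b \<^bold>+ c)) ((a \<^bold>+ b) \<^bold>+ c)"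
| "AC_rule (a \<^bold>+ b) (b \<^bold>+ a)"
| "AC_rule (a \<^bold>\<times> (b \<^bold>\<times> c)) ((a \<^bold>\<times> b) \<^bold>\<times> c)"

inductive AC_step :: "'a trm \<Rightarrow> 'a trm \<Rightarrow> bool" where
  "AC_rule s t \<Longrightarrow> AC_step s t"
| "AC_rule s t \<Longrightarrow> AC_step t s"
| "AC_step s s' \<Longrightarrow> AC_step (s \<^bold>+ t) (s' \<^bold>+ t)"
| "AC_step t t' \<Longrightarrow> AC_step (s \<^bold>+ t) (s \<^bold>+ t')"
| "AC_step s s' \<Longrightarrow> AC_step (s \<^bold>\<times> t) (s' \<^bold>\<times> t)"
| "AC_step t t' \<Longrightarrow> AC_step (s \<^bold>\<times> t) (s \<^bold>\<times> t')"

text \<open>No carrier is needed here: a step out of a simple term over \<open>X\<close> again leads to a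
  simple term over \<open>X\<close>.\<close>

definition eq_AC :: "'a trm \<Rightarrow> 'a trm \<Rightarrow> bool" where
  "eq_AC = AC_step\<^sup>*\<^sup>*"

inductive_set monomial_terms :: "'a set \<Rightarrow> 'a trm set" for X :: "'a set" where
  "x \<in> X \<Longrightarrow> Var x \<in> monomial_terms X"
| "\<lbrakk>s \<in> monomial_terms X; t \<in> monomial_terms X\<rbrakk> \<Longrightarrow> s \<^bold>\<times> t \<in> monomial_terms X"

inductive_set PT :: "'a set \<Rightarrow> 'a trm set" for X :: "'a set" where
  zero: "\<^bold>0 \<in> PT X"
| one: "\<^bold>1 \<in> PT X"
| monomial: "s \<in> monomial_terms X \<Longrightarrow> s \<in> PT X"
| plus: "\<lbrakk>s \<in> PT X; s \<noteq> \<^bold>0; t \<in> PT X; t \<noteq> \<^bold>0\<rbrakk> \<Longrightarrow> s \<^bold>+ t \<in> PT X"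
| times: "\<lbrakk>s \<in> monomial_terms X; t \<in> PT X; t \<noteq> \<^bold>0; t \<noteq> \<^bold>1\<rbrakk> \<Longrightarrow> s \<^bold>\<times> t \<in> PT X"

definition sum_terms :: "'a set \<Rightarrow> 'a trm set" where
  "sum_terms X = {t \<in> ST X. \<exists>s\<^sub>1 \<in> ST X - {\<^bold>0}. \<exists>s\<^sub>2 \<in> ST X - {\<^bold>0}. t = s\<^sub>1 \<^bold>+ s\<^sub>2}"

definition product_terms :: "'a set \<Rightarrow> 'a trm set" where
  "product_terms X =
     {t \<in> ST X. \<exists>s\<^sub>1 \<in> ST X - {\<^bold>0, \<^bold>1}. \<exists>s\<^sub>2 \<in> ST X - {\<^bold>0, \<^bold>1}. t = s\<^sub>1 \<^bold>\<times> s\<^sub>2}"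

text \<open>\<open>sum_of ts t\<close>: the term \<open>t\<close> is obtained by inserting parentheses into the formal sum
  of the nonempty list \<open>ts\<close>.\<close>

inductive sum_of :: "'a trm list \<Rightarrow> 'a trm \<Rightarrow> bool" where
  single: "sum_of [t] t"
| plus: "\<lbrakk>sum_of ss s; sum_of ts t\<rbrakk> \<Longrightarrow> sum_of (ss @ ts) (s \<^bold>+ t)"

definition sum_product_decomposition :: "'a set \<Rightarrow> 'a trm \<Rightarrow> 'a trm list \<Rightarrow> bool" where
  "sum_product_decomposition X t ts \<longleftrightarrow>
     t \<in> sum_terms X \<and> 2 \<le> length ts \<and> set ts \<subseteq> product_terms X \<union> Var ` X \<union> {\<^bold>1} \<and> sum_of ts t"

inductive_set STid :: "'a set \<Rightarrow> 'a trm set" for X :: "'a set" where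
  zero: "\<^bold>0 \<in> STid X"
| one: "\<^bold>1 \<in> STid X"
| monomial: "s \<in> monomial_terms X \<Longrightarrow> s \<in> STid X"
| sum: "\<lbrakk>sum_product_decomposition X t ts; \<And>t'. t' \<in> set ts \<Longrightarrow> t' \<in> STid X;
    \<And>i j. i < j \<Longrightarrow> j < length ts \<Longrightarrow> \<not> eq_AC (ts ! i) (ts ! j)\<rbrakk> \<Longrightarrow> t \<in> STid X"
| times: "\<lbrakk>s \<in> STid X; s \<noteq> \<^bold>0; s \<noteq> \<^bold>1; t \<in> STid X; t \<noteq> \<^bold>0; t \<noteq> \<^bold>1\<rbrakk> \<Longrightarrow> s \<^bold>\<times> t \<in> STid X"

definition PTid :: "'a set \<Rightarrow> 'a trm set" where
  "PTid X = PT X \<inter> STid X"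

text \<open>\<open>PT\<close> and \<open>STid\<close> are generated inside all terms; the closure conditions stay inside
  \<open>ST X\<close>, so these are also the smallest such subsets of \<open>ST X\<close>.\<close>

lemma self_subterm: "t \<in> subterms t"
  by (cases t) auto

lemma ST_simps:
  "\<^bold>0 \<in> ST X" "\<^bold>1 \<in> ST X" "Var x \<in> ST X \<longleftrightarrow> x \<in> X"
  "s \<^bold>+ t \<in> ST X \<longleftrightarrow> s \<in> ST X - {\<^bold>0} \<and> t \<in> ST X - {\<^bold>0}"
  "s \<^bold>\<times> t \<in> ST X \<longleftrightarrow> s \<in> ST X - {\<^bold>0, \<^bold>1} \<and> t \<in> ST X - {\<^bold>0, \<^bold>1}"
  using self_subterm[of s] self_subterm[of t]
  by (auto simp: ST_def T_def simple_def)

lemma monomial_terms_subset: "monomial_terms X \<subseteq> ST X - {\<^bold>0, \<^bold>1}"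
proof
  show "t \<in> ST X - {\<^bold>0, \<^bold>1}" if "t \<in> monomial_terms X" for t
    using that by induction (auto simp: ST_simps)
qed

lemma PT_subset_ST: "PT X \<subseteq> ST X"
proof
  show "t \<in> ST X" if "t \<in> PT X" for t
    using that by induction (use monomial_terms_subset[of X] in \<open>auto simp: ST_simps\<close>)
qed

lemma STid_subset_ST: "STid X \<subseteq> ST X"
proof
  show "t \<in> ST X" if "t \<in> STid X" for t
    using that
    by induction
      (use monomial_terms_subset[of X] in
        \<open>auto simp: ST_simps sum_product_decomposition_def sum_terms_def\<close>)
qed

fun summands :: "'a trm \<Rightarrow> 'a trm list" where
  "summands (s \<^bold>+ t) = summands s @ summands t"
| "summands t = [t]"

lemma sum_of_summands: "sum_of (summands t) t"
  by (induction t) (auto intro: sum_of.intros)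

lemma summands_unique:
  "sum_of ts t \<Longrightarrow> (\<And>s s'. s \<^bold>+ s' \<notin> set ts) \<Longrightarrow> ts = summands t"
proof (induction rule: sum_of.induct)
  case (single t)
  then show ?case by (cases t) auto
qed auto

lemma set_summands: "t \<in> ST X - {\<^bold>0} \<Longrightarrow> set (summands t) \<subseteq> product_terms X \<union> Var ` X \<union> {\<^bold>1}"
  by (induction t) (auto simp: ST_simps product_terms_def)

lemma length_summands: "1 \<le> length (summands t)"
  by (induction t) auto

lemma sum_product_decomposition_iff:
  "sum_product_decomposition X t ts \<longleftrightarrow> t \<in> sum_terms X \<and> ts = summands t"
proof
  assume "sum_product_decomposition X t ts"
  then show "t \<in> sum_terms X \<and> ts = summands t"
    using summands_unique[of ts t]
    by (auto simp: sum_product_decomposition_def product_terms_def)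
next
  assume *: "t \<in> sum_terms X \<and> ts = summands t"
  then obtain s\<^sub>1 s\<^sub>2 where "t = s\<^sub>1 \<^bold>+ s\<^sub>2" by (auto simp: sum_terms_def)
  then have "2 \<le> length ts"
    using * length_summands[of s\<^sub>1] length_summands[of s\<^sub>2] by simp
  moreover have "t \<in> ST X - {\<^bold>0}"
    using * \<open>t = _\<close> by (auto simp: sum_terms_def)
  ultimately show "sum_product_decomposition X t ts"
    using * set_summands[of t X] sum_of_summands[of t]
    by (simp add: sum_product_decomposition_def)
qed

lemma sum_product_decomposition_ex1:
  "t \<in> sum_terms X \<Longrightarrow> \<exists>!ts. sum_product_decomposition X t ts"
  by (simp add: sum_product_decomposition_iff)

lemma AC_step_ST: "AC_step s t \<Longrightarrow> s \<in> ST X - {\<^bold>0, \<^bold>1} \<longleftrightarrow> t \<in> ST X - {\<^bold>0, \<^bold>1}"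
proof (induction rule: AC_step.induct)
  case (3 s s' t)
  then show ?case by (auto simp: ST_simps elim: AC_step.cases AC_rule.cases)
next
  case (4 t t' s)
  then show ?case by (auto simp: ST_simps elim: AC_step.cases AC_rule.cases)
qed (auto simp: ST_simps elim!: AC_rule.cases)

end

theory Submission
  imports Defs
begin

text \<open>
  Simple and polynomial normal forms come from structural induction on the given term, so it is
  enough that each of the two classes is closed, up to the congruence, under sums and products
  (\<open>normal_form_exists\<close>).  The idempotent form is obtained from the polynomial one.

  Simple terms: \<open>\<^bold>0\<close> and \<open>\<^bold>1\<close> are absorbed by their unit and annihilation laws, and otherwise
  the sum or product of simple terms is simple.

  Polynomial terms: only products are a problem, because the left factor of a product must be
  a monomial.  Recursion on the left factor pushes the right factor inwards, through sums by
  right distributivity and past monomial prefixes by associativity, until it meets a monomial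
  or \<open>\<^bold>1\<close> (\<open>times_PT_nontrivial\<close>).  There the right factor stays as it is, even if it
  is a sum: a monomial times a polynomial sum is already a polynomial term.

  Idempotent polynomial terms: every polynomial term is reduced by recursion on its
  construction.  For a sum, the summands of the left-hand term are added one at a time to the
  right-hand one (\<open>plus_PTid\<close>).  A summand that already occurs there up to AC is absorbed by
  idempotence (\<open>absorb_summand\<close>); any other summand keeps the list of summands
  pairwise AC-distinct, so that by \<open>STid_iff_summands\<close> the sum stays idempotent-simple.  For a product
  \<open>s \<^bold>\<times> t\<close> one reduces \<open>t\<close>; if it collapses to \<open>\<^bold>1\<close>, as \<open>\<^bold>1 \<^bold>+ \<^bold>1\<close> does, the monomial \<open>s\<close> is left.
\<close>

section \<open>Summands of polynomial and idempotent terms\<close>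

lemma T_simps:
  "\<^bold>0 \<in> T X" "\<^bold>1 \<in> T X" "Var x \<in> T X \<longleftrightarrow> x \<in> X"
  "s \<^bold>+ t \<in> T X \<longleftrightarrow> s \<in> T X \<and> t \<in> T X" "s \<^bold>\<times> t \<in> T X \<longleftrightarrow> s \<in> T X \<and> t \<in> T X"
  by (auto simp: T_def)

lemma ST_subset_T: "ST X \<subseteq> T X"
  by (auto simp: ST_def)

lemma PT_subset_T: "PT X \<subseteq> T X"
  using PT_subset_ST ST_subset_T by blast

lemma monomial_terms_nontrivial:
  "\<^bold>0 \<notin> monomial_terms X" "\<^bold>1 \<notin> monomial_terms X" "s \<^bold>+ t \<notin> monomial_terms X"
  by (auto elim: monomial_terms.cases)

lemma PT_plus_iff: "s \<^bold>+ t \<in> PT X \<longleftrightarrow> s \<in> PT X - {\<^bold>0} \<and> t \<in> PT X - {\<^bold>0}"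
  by (auto intro: PT.plus elim: PT.cases simp: monomial_terms_nontrivial)

lemma summands_nonsum: "(\<And>s t. u \<noteq> s \<^bold>+ t) \<Longrightarrow> summands u = [u]"
  by (cases u) auto

text \<open>The generating clauses speak about sum terms, where the decomposition into summands has
  length at least two.  A term that is not a sum is its own only summand, so that
  the criterion below holds for it as well, and no case distinction is needed later.\<close>

lemma STid_iff_summands:
  "u \<in> STid X \<longleftrightarrow>
     u \<in> ST X \<and> set (summands u) \<subseteq> STid X \<and> sorted_wrt (\<lambda>a b. \<not> eq_AC a b) (summands u)"
proof (cases "\<exists>s t. u = s \<^bold>+ t")
  case False
  then have "summands u = [u]"
    by (intro summands_nonsum) auto
  then show ?thesis
    using STid_subset_ST by auto
next
  case True
  then obtain s t where u: "u = s \<^bold>+ t" by auto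
  show ?thesis
  proof
    assume "u \<in> STid X"
    then show "u \<in> ST X \<and> set (summands u) \<subseteq> STid X
        \<and> sorted_wrt (\<lambda>a b. \<not> eq_AC a b) (summands u)"
    proof cases
      case (sum ts)
      then have "ts = summands u" "u \<in> ST X"
        by (simp_all add: sum_product_decomposition_iff sum_terms_def)
      with sum show ?thesis
        by (auto simp: sorted_wrt_iff_nth_less)
    qed (use u in \<open>simp_all add: monomial_terms_nontrivial\<close>)
  next
    assume *: "u \<in> ST X \<and> set (summands u) \<subseteq> STid X
        \<and> sorted_wrt (\<lambda>a b. \<not> eq_AC a b) (summands u)"
    then have "sum_product_decomposition X u (summands u)"
      using u by (auto simp: sum_product_decomposition_iff sum_terms_def ST_simps)
    then show "u \<in> STid X"
      by (rule STid.sum) (use * in \<open>auto simp: sorted_wrt_iff_nth_less\<close>)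
  qed
qed

section \<open>Congruences containing the base identities\<close>

text \<open>Congruences are treated abstractly, so that what follows from the base identities serves
  all three equational theories.\<close>

locale E_congruence =
  fixes X :: "'a set" and r :: "('a trm \<times> 'a trm) set"
  assumes cong: "congruence X r" and E_sub: "E_pairs X \<subseteq> r"
begin

abbreviation equivalent :: "'a trm \<Rightarrow> 'a trm \<Rightarrow> bool" (infix "\<approx>" 50) where
  "s \<approx> t \<equiv> (s, t) \<in> r"

lemma eqv_refl: "t \<in> T X \<Longrightarrow> t \<approx> t"
  using cong by (auto simp: congruence_def equiv_def dest: refl_onD)

lemma eqv_sym: "s \<approx> t \<Longrightarrow> t \<approx> s"
  using cong by (auto simp: congruence_def equiv_def dest: symD)

lemma eqv_trans [trans]: "s \<approx> t \<Longrightarrow> t \<approx> u \<Longrightarrow> s \<approx> u"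
  using cong by (auto simp: congruence_def equiv_def dest: transD)

lemma eqv_plus: "s \<approx> s' \<Longrightarrow> t \<approx> t' \<Longrightarrow> s \<^bold>+ t \<approx> s' \<^bold>+ t'"
  and eqv_times: "s \<approx> s' \<Longrightarrow> t \<approx> t' \<Longrightarrow> s \<^bold>\<times> t \<approx> s' \<^bold>\<times> t'"
  using cong by (auto simp: congruence_def)

lemma plus_assoc: "\<lbrakk>a \<in> T X; b \<in> T X; c \<in> T X\<rbrakk> \<Longrightarrow> a \<^bold>+ (b \<^bold>+ c) \<approx> (a \<^bold>+ b) \<^bold>+ c"
  and plus_comm: "\<lbrakk>a \<in> T X; b \<in> T X\<rbrakk> \<Longrightarrow> a \<^bold>+ b \<approx> b \<^bold>+ a"
  and plus_zero: "a \<in> T X \<Longrightarrow> a \<^bold>+ \<^bold>0 \<approx> a"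
  and times_assoc: "\<lbrakk>a \<in> T X; b \<in> T X; c \<in> T X\<rbrakk> \<Longrightarrow> a \<^bold>\<times> (b \<^bold>\<times> c) \<approx> (a \<^bold>\<times> b) \<^bold>\<times> c"
  and one_times: "a \<in> T X \<Longrightarrow> \<^bold>1 \<^bold>\<times> a \<approx> a"
  and times_one: "a \<in> T X \<Longrightarrow> a \<^bold>\<times> \<^bold>1 \<approx> a"
  and times_zero: "a \<in> T X \<Longrightarrow> a \<^bold>\<times> \<^bold>0 \<approx> \<^bold>0"
  and zero_times: "a \<in> T X \<Longrightarrow> \<^bold>0 \<^bold>\<times> a \<approx> \<^bold>0"
  using E_sub by (auto intro: E_pairs.intros)

lemma zero_plus: "a \<in> T X \<Longrightarrow> \<^bold>0 \<^bold>+ a \<approx> a"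
  using eqv_trans[OF plus_comm plus_zero] by (simp add: T_simps)

lemma AC_step_eqv: "AC_step s t \<Longrightarrow> (s \<in> T X \<longleftrightarrow> t \<in> T X) \<and> (s \<in> T X \<longrightarrow> s \<approx> t)"
proof (induction rule: AC_step.induct)
  case (1 s t)
  then show ?case
    by cases (auto simp: T_simps intro: plus_assoc plus_comm times_assoc)
next
  case (2 s t)
  then show ?case
    by cases (auto simp: T_simps intro: eqv_sym plus_assoc plus_comm times_assoc)
qed (auto simp: T_simps intro: eqv_plus eqv_times eqv_refl)

lemma eq_AC_eqv:
  assumes "eq_AC s t" "s \<in> T X"
  shows "t \<in> T X \<and> s \<approx> t"
  using assms(1) unfolding eq_AC_def
proof (induction rule: rtranclp_induct)
  case base
  then show ?case using assms(2) by (simp add: eqv_refl)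
next
  case (step y z)
  then show ?case using AC_step_eqv[of y z] by (blast intro: eqv_trans)
qed

text \<open>A class of normal forms only has to be closed under sums and products of
  \<^emph>\<open>nontrivial\<close> members: the base identities dispose of \<open>\<^bold>0\<close> and \<open>\<^bold>1\<close> in all other cases.\<close>

lemma normal_form_exists:
  assumes "t \<in> T X" and "U \<subseteq> T X" and "\<^bold>0 \<in> U" and "\<^bold>1 \<in> U" and "Var ` X \<subseteq> U"
    and plus: "\<And>p q. p \<in> U - {\<^bold>0} \<Longrightarrow> q \<in> U - {\<^bold>0} \<Longrightarrow> \<exists>u\<in>U. p \<^bold>+ q \<approx> u"
    and times: "\<And>p q. p \<in> U - {\<^bold>0, \<^bold>1} \<Longrightarrow> q \<in> U - {\<^bold>0, \<^bold>1} \<Longrightarrow> \<exists>u\<in>U. p \<^bold>\<times> q \<approx> u"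
  shows "\<exists>u\<in>U. t \<approx> u"
  using assms(1)
proof (induction t)
  case (Plus s t)
  then obtain p q where p: "p \<in> U" "s \<approx> p" and q: "q \<in> U" "t \<approx> q"
    by (auto simp: T_simps)
  have "p \<in> T X" "q \<in> T X" using p q assms(2) by auto
  then have "\<exists>u\<in>U. p \<^bold>+ q \<approx> u"
    using plus[of p q] p q
    by (cases "p = \<^bold>0"; cases "q = \<^bold>0") (auto intro: plus_zero zero_plus)
  then show ?case
    using eqv_plus[OF p(2) q(2)] by (blast intro: eqv_trans)
next
  case (Times s t)
  then obtain p q where p: "p \<in> U" "s \<approx> p" and q: "q \<in> U" "t \<approx> q"
    by (auto simp: T_simps)
  have pq: "p \<in> T X" "q \<in> T X" using p q assms(2) by auto
  consider "p = \<^bold>0" | "q = \<^bold>0" | "p = \<^bold>1" | "q = \<^bold>1" | "p \<in> U - {\<^bold>0, \<^bold>1}" "q \<in> U - {\<^bold>0, \<^bold>1}"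
    using p q by blast
  then have "\<exists>u\<in>U. p \<^bold>\<times> q \<approx> u"
  proof cases
    case 1 then show ?thesis using zero_times[OF pq(2)] assms(3) by auto
  next
    case 2 then show ?thesis using times_zero[OF pq(1)] assms(3) by auto
  next
    case 3 then show ?thesis using one_times[OF pq(2)] q(1) by auto
  next
    case 4 then show ?thesis using times_one[OF pq(1)] p(1) by auto
  qed (rule times)
  then show ?case
    using eqv_times[OF p(2) q(2)] by (blast intro: eqv_trans)
next
  case (Var x)
  then have "Var x \<approx> Var x" "x \<in> X" by (auto simp: T_simps intro: eqv_refl)
  then show ?case using assms(5) by blast
next
  case Zero
  then show ?case using assms(3) eqv_refl by blast
next
  case One
  then show ?case using assms(4) eqv_refl by blast
qed

lemma ex_simple_term:
  assumes "t \<in> T X"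
  shows "\<exists>u\<in>ST X. t \<approx> u"
proof (rule normal_form_exists[OF assms ST_subset_T])
  show "\<exists>u\<in>ST X. p \<^bold>+ q \<approx> u" if "p \<in> ST X - {\<^bold>0}" "q \<in> ST X - {\<^bold>0}" for p q
    using that ST_subset_T[of X]
    by (intro bexI[of _ "p \<^bold>+ q"] eqv_refl) (auto simp: ST_simps T_simps)
  show "\<exists>u\<in>ST X. p \<^bold>\<times> q \<approx> u" if "p \<in> ST X - {\<^bold>0, \<^bold>1}" "q \<in> ST X - {\<^bold>0, \<^bold>1}" for p q
    using that ST_subset_T[of X]
    by (intro bexI[of _ "p \<^bold>\<times> q"] eqv_refl) (auto simp: ST_simps T_simps)
qed (auto simp: ST_simps)

end

section \<open>Polynomial terms and right distributivity\<close>

locale E_rd_congruence = E_congruence +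
  assumes rd_sub: "rd_pairs X \<subseteq> r"
begin

lemma right_distrib:
  "\<lbrakk>a \<in> T X; b \<in> T X; c \<in> T X\<rbrakk> \<Longrightarrow> (a \<^bold>+ b) \<^bold>\<times> c \<approx> (a \<^bold>\<times> c) \<^bold>+ (b \<^bold>\<times> c)"
  using rd_sub by (auto simp: rd_pairs_def)

text \<open>The case \<open>p = \<^bold>1\<close> has to be covered because \<open>\<^bold>1\<close> occurs among the summands of polynomial
  terms.  Excluding \<open>q = \<^bold>1\<close> keeps the result different from \<open>\<^bold>1\<close> throughout the recursion,
  as it must be in order to be prefixed with a monomial.\<close>

lemma times_PT_nontrivial:
  assumes "p \<in> PT X" "p \<noteq> \<^bold>0" and q: "q \<in> PT X - {\<^bold>0, \<^bold>1}"
  shows "\<exists>u \<in> PT X - {\<^bold>0, \<^bold>1}. p \<^bold>\<times> q \<approx> u"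
proof -
  have qT: "q \<in> T X" using q PT_subset_T by auto
  show ?thesis
    using assms(1,2)
  proof (induction p)
    case one
    then show ?case using one_times[OF qT] q by auto
  next
    case (monomial s)
    then have "s \<^bold>\<times> q \<in> PT X"
      using q by (auto intro: PT.times)
    moreover from this have "s \<^bold>\<times> q \<approx> s \<^bold>\<times> q"
      using PT_subset_T by (blast intro: eqv_refl)
    ultimately show ?case by blast
  next
    case (plus s t)
    then obtain u v where u: "u \<in> PT X - {\<^bold>0, \<^bold>1}" "s \<^bold>\<times> q \<approx> u"
      and v: "v \<in> PT X - {\<^bold>0, \<^bold>1}" "t \<^bold>\<times> q \<approx> v"
      by blast
    have "(s \<^bold>+ t) \<^bold>\<times> q \<approx> (s \<^bold>\<times> q) \<^bold>+ (t \<^bold>\<times> q)"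
      using plus PT_subset_T qT by (blast intro: right_distrib)
    also have "(s \<^bold>\<times> q) \<^bold>+ (t \<^bold>\<times> q) \<approx> u \<^bold>+ v"
      using u v by (blast intro: eqv_plus)
    finally have "(s \<^bold>+ t) \<^bold>\<times> q \<approx> u \<^bold>+ v" .
    moreover have "u \<^bold>+ v \<in> PT X - {\<^bold>0, \<^bold>1}"
      using u v by (simp add: PT_plus_iff)
    ultimately show ?case by blast
  next
    case (times s t)
    then obtain u where u: "u \<in> PT X - {\<^bold>0, \<^bold>1}" "t \<^bold>\<times> q \<approx> u"
      by blast
    have sT: "s \<in> T X" and tT: "t \<in> T X"
      using times PT.monomial PT_subset_T by blast+
    have "(s \<^bold>\<times> t) \<^bold>\<times> q \<approx> s \<^bold>\<times> (t \<^bold>\<times> q)"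
      using times_assoc[OF sT tT qT] by (rule eqv_sym)
    also have "s \<^bold>\<times> (t \<^bold>\<times> q) \<approx> s \<^bold>\<times> u"
      using u sT by (blast intro: eqv_times eqv_refl)
    finally have "(s \<^bold>\<times> t) \<^bold>\<times> q \<approx> s \<^bold>\<times> u" .
    moreover have "s \<^bold>\<times> u \<in> PT X - {\<^bold>0, \<^bold>1}"
      using u times by (auto intro: PT.times)
    ultimately show ?case by blast
  qed simp
qed

lemma ex_polynomial_term:
  assumes "t \<in> T X"
  shows "\<exists>u\<in>PT X. t \<approx> u"
proof (rule normal_form_exists[OF assms PT_subset_T])
  show "\<exists>u\<in>PT X. p \<^bold>+ q \<approx> u" if "p \<in> PT X - {\<^bold>0}" "q \<in> PT X - {\<^bold>0}" for p q
    using that PT_subset_T[of X]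
    by (intro bexI[of _ "p \<^bold>+ q"] eqv_refl) (auto simp: PT_plus_iff T_simps)
  show "\<exists>u\<in>PT X. p \<^bold>\<times> q \<approx> u" if "p \<in> PT X - {\<^bold>0, \<^bold>1}" "q \<in> PT X - {\<^bold>0, \<^bold>1}" for p q
    using times_PT_nontrivial[of p q] that by blast
qed (auto intro: PT.intros monomial_terms.intros)

end

section \<open>Eliminating duplicate summands by idempotence\<close>

locale E_id_rd_congruence = E_rd_congruence +
  assumes id_sub: "id_pairs X \<subseteq> r"
begin

lemma plus_idem: "a \<in> T X \<Longrightarrow> a \<^bold>+ a \<approx> a"
  using id_sub by (auto simp: id_pairs_def)

text \<open>Reassociating and commuting brings \<open>b\<close> next to its own occurrence deep inside \<open>u\<close>, where
  idempotence swallows it.\<close>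

lemma absorb_summand:
  assumes "b \<in> set (summands u)" "u \<in> T X" "b \<in> T X"
  shows "b \<^bold>+ u \<approx> u"
  using assms
proof (induction u)
  case (Plus u v)
  then have T: "u \<in> T X" "v \<in> T X" by (auto simp: T_simps)
  have left: "b \<^bold>+ (s \<^bold>+ t) \<approx> s \<^bold>+ t" if "b \<^bold>+ s \<approx> s" "s \<in> T X" "t \<in> T X" for s t
  proof -
    have "b \<^bold>+ (s \<^bold>+ t) \<approx> (b \<^bold>+ s) \<^bold>+ t"
      using that Plus.prems by (blast intro: plus_assoc)
    also have "(b \<^bold>+ s) \<^bold>+ t \<approx> s \<^bold>+ t"
      using that by (blast intro: eqv_plus eqv_refl)
    finally show ?thesis .
  qed
  show ?case
  proof (cases "b \<in> set (summands u)")
    case True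
    then show ?thesis using Plus T by (blast intro: left)
  next
    case False
    then have "b \<in> set (summands v)"
      using Plus.prems by simp
    then have v: "b \<^bold>+ v \<approx> v"
      using Plus T by blast
    have "b \<^bold>+ (u \<^bold>+ v) \<approx> b \<^bold>+ (v \<^bold>+ u)"
      using Plus.prems T by (blast intro: eqv_plus eqv_refl plus_comm)
    also have "b \<^bold>+ (v \<^bold>+ u) \<approx> v \<^bold>+ u"
      using v T by (blast intro: left)
    also have "v \<^bold>+ u \<approx> u \<^bold>+ v"
      using T by (blast intro: plus_comm)
    finally show ?thesis .
  qed
qed (auto intro: plus_idem)

lemma insert_summand_PTid:
  assumes a: "a \<in> PTid X" "a \<noteq> \<^bold>0" "summands a = [a]" and u: "u \<in> PTid X" "u \<noteq> \<^bold>0"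
  shows "\<exists>v \<in> PTid X - {\<^bold>0}. a \<^bold>+ u \<approx> v"
proof -
  have T: "a \<in> T X" "u \<in> T X"
    using a u PT_subset_T by (auto simp: PTid_def)
  show ?thesis
  proof (cases "\<exists>b\<in>set (summands u). eq_AC a b")
    case True
    then obtain b where b: "b \<in> set (summands u)" "eq_AC a b" by blast
    then have bT: "b \<in> T X" and "a \<approx> b"
      using T eq_AC_eqv by auto
    have "a \<^bold>+ u \<approx> b \<^bold>+ u"
      using \<open>a \<approx> b\<close> T by (blast intro: eqv_plus eqv_refl)
    also have "b \<^bold>+ u \<approx> u"
      using b bT T by (blast intro: absorb_summand)
    finally show ?thesis using u by blast
  next
    case False
    have PT: "a \<^bold>+ u \<in> PT X"
      using a u by (simp add: PTid_def PT_plus_iff)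
    moreover have "a \<^bold>+ u \<in> STid X"
      using PT PT_subset_ST False a u STid_iff_summands[of u X]
      by (subst STid_iff_summands) (auto simp: PTid_def)
    ultimately have "a \<^bold>+ u \<in> PTid X - {\<^bold>0}"
      by (simp add: PTid_def)
    then show ?thesis
      using T by (blast intro: eqv_refl eqv_plus)
  qed
qed

text \<open>The recursion splits \<open>s\<close> and inserts its summands into \<open>u\<close> from right to left, comparing each
  with everything collected so far.  The condition on \<open>s\<close> concerns single summands only, so that
  both halves of a sum inherit it at once.\<close>

lemma plus_PTid:
  assumes "s \<in> PT X" "s \<noteq> \<^bold>0" "set (summands s) \<subseteq> STid X" "u \<in> PTid X" "u \<noteq> \<^bold>0"
  shows "\<exists>v \<in> PTid X - {\<^bold>0}. s \<^bold>+ u \<approx> v"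
  using assms
proof (induction s arbitrary: u rule: trm.induct)
  case (Plus s t)
  then have st: "s \<in> PT X" "s \<noteq> \<^bold>0" "t \<in> PT X" "t \<noteq> \<^bold>0"
    by (auto simp: PT_plus_iff)
  have T: "s \<in> T X" "t \<in> T X" "u \<in> T X"
    using st Plus.prems PT_subset_T by (auto simp: PTid_def)
  obtain v where v: "v \<in> PTid X - {\<^bold>0}" "t \<^bold>+ u \<approx> v"
    using Plus.IH(2)[of u] st Plus.prems by auto
  obtain w where w: "w \<in> PTid X - {\<^bold>0}" "s \<^bold>+ v \<approx> w"
    using Plus.IH(1)[of v] st v Plus.prems by auto
  have "(s \<^bold>+ t) \<^bold>+ u \<approx> s \<^bold>+ (t \<^bold>+ u)"
    using T by (blast intro: eqv_sym plus_assoc)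
  also have "s \<^bold>+ (t \<^bold>+ u) \<approx> s \<^bold>+ v"
    using T v by (blast intro: eqv_plus eqv_refl)
  also have "s \<^bold>+ v \<approx> w"
    by (rule w(2))
  finally show ?case using w by blast
qed (rule insert_summand_PTid; simp add: PTid_def)+

lemma PT_reduces_to_PTid:
  assumes "t \<in> PT X"
  shows "\<exists>u\<in>PTid X. (t \<noteq> \<^bold>0 \<longrightarrow> u \<noteq> \<^bold>0) \<and> t \<approx> u"
  using assms
proof (induction t)
  case zero
  have "\<^bold>0 \<in> PTid X" by (auto simp: PTid_def intro: PT.zero STid.zero)
  then show ?case using eqv_refl T_simps by blast
next
  case one
  have "\<^bold>1 \<in> PTid X" by (auto simp: PTid_def intro: PT.one STid.one)
  then show ?case using eqv_refl T_simps by blast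
next
  case (monomial s)
  then have "s \<in> PTid X" "s \<in> T X"
    using PT.monomial PT_subset_T by (auto simp: PTid_def intro: STid.monomial)
  then show ?case by (blast intro: eqv_refl)
next
  case (plus s t)
  then obtain p q where p: "p \<in> PTid X" "p \<noteq> \<^bold>0" "s \<approx> p" and q: "q \<in> PTid X" "q \<noteq> \<^bold>0" "t \<approx> q"
    by blast
  then obtain u where "u \<in> PTid X - {\<^bold>0}" "p \<^bold>+ q \<approx> u"
    using plus_PTid[of p q] STid_iff_summands[of p X] by (auto simp: PTid_def)
  then show ?case
    using eqv_plus[OF p(3) q(3)] by (blast intro: eqv_trans)
next
  case (times s t)
  then obtain u where u: "u \<in> PTid X" "u \<noteq> \<^bold>0" "t \<approx> u"
    by blast
  have s: "s \<in> PTid X" "s \<in> T X" "s \<noteq> \<^bold>0" "s \<noteq> \<^bold>1"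
    using times.hyps(1) PT_subset_T[of X] monomial_terms_nontrivial(1,2)[of X]
    by (auto simp: PTid_def intro: STid.monomial PT.monomial)
  have su: "s \<^bold>\<times> t \<approx> s \<^bold>\<times> u"
    using u s by (blast intro: eqv_times eqv_refl)
  show ?case
  proof (cases "u = \<^bold>1")
    case True
    then have "s \<^bold>\<times> t \<approx> s"
      using su times_one[OF s(2)] by (blast intro: eqv_trans)
    then show ?thesis using s by blast
  next
    case False
    then have "s \<^bold>\<times> u \<in> PTid X"
      using times u s by (auto simp: PTid_def intro: PT.times STid.times)
    then show ?thesis using su by blast
  qed
qed

lemma ex_idempotent_polynomial_term:
  assumes "t \<in> T X"
  shows "\<exists>u\<in>PTid X. t \<approx> u"
  using ex_polynomial_term[OF assms] PT_reduces_to_PTid by (blast intro: eqv_trans)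

end

section \<open>Normal forms in the three equational theories\<close>

lemma E_pairs_subset_T: "E_pairs X \<subseteq> T X \<times> T X"
  by (auto elim!: E_pairs.cases simp: T_simps)

lemma rd_pairs_subset_T: "rd_pairs X \<subseteq> T X \<times> T X"
  by (auto simp: rd_pairs_def T_simps)

lemma id_pairs_subset_T: "id_pairs X \<subseteq> T X \<times> T X"
  by (auto simp: id_pairs_def T_simps)

lemma E_congruence_eq_E: "E_congruence X (eq_E X)"
  unfolding eq_E_def using congruence_gen_congruence[OF E_pairs_subset_T]
  by unfold_locales (auto intro: gen_congruence.base)

lemma E_rd_congruence_eq_E_rd: "E_rd_congruence X (eq_E_rd X)"
  unfolding eq_E_rd_def
  using congruence_gen_congruence[OF Un_least[OF E_pairs_subset_T rd_pairs_subset_T]]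
  by unfold_locales (auto intro: gen_congruence.base)

lemma E_id_rd_congruence_eq_E_id_rd: "E_id_rd_congruence X (eq_E_id_rd X)"
  unfolding eq_E_id_rd_def
  using congruence_gen_congruence
    [OF Un_least[OF Un_least[OF E_pairs_subset_T rd_pairs_subset_T] id_pairs_subset_T]]
  by unfold_locales (auto intro: gen_congruence.base)

theorem theorem5p5:
  fixes X :: "'a set" and t :: "'a trm"
  assumes "X \<noteq> {}"
    and "t \<in> T X"
  shows "\<exists>t\<^sub>1 \<in> ST X. \<exists>t\<^sub>2 \<in> PT X. \<exists>t\<^sub>3 \<in> PTid X.
    (t, t\<^sub>1) \<in> eq_E X \<and> (t, t\<^sub>2) \<in> eq_E_rd X \<and> (t, t\<^sub>3) \<in> eq_E_id_rd X"
  using E_congruence.ex_simple_term[OF E_congruence_eq_E assms(2)]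
    E_rd_congruence.ex_polynomial_term[OF E_rd_congruence_eq_E_rd assms(2)]
    E_id_rd_congruence.ex_idempotent_polynomial_term[OF E_id_rd_congruence_eq_E_id_rd assms(2)]
  by blast

end
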